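(* Let $m, n$ be fixed coprime natural numbers. Let $G$ be a finite group such that $a^m b^m = b^m a^m$ and $a^n b^n = b^n a^n$ for all $a, b \in G$. Then $G$ is abelian.
   Context: Natural numbers are positive integers. *)

theory Defs
  imports "HOL-Algebra.Group"
begin

end

theory Submission
  imports Defs
begin

text \<open>
  Let \<open>p\<close> be an \<open>m\<close>-th power and \<open>q\<close> an \<open>n\<close>-th power, and let \<open>c\<close> be their commutator. Splitting
  \<open>c\<close> as \<open>p (q p\<^sup>-\<^sup>1 q\<^sup>-\<^sup>1)\<close> shows that it is a product of two \<open>m\<close>-th powers, and splitting it as
  \<open>(p q p\<^sup>-\<^sup>1) q\<^sup>-\<^sup>1\<close> shows that it is a product of two \<open>n\<close>-th powers. So \<open>c\<close> commutes with all \<open>m\<close>-th and all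
  \<open>n\<close>-th powers and is therefore central. But \<open>p\<^sup>n\<close> is an \<open>n\<close>-th power and \<open>q\<^sup>m\<close> is an \<open>m\<close>-th power,
  whence \<open>c\<^sup>n = [p\<^sup>n, q] = 1\<close> and \<open>c\<^sup>m = [p, q\<^sup>m] = 1\<close>, so \<open>c = 1\<close>. Thus
  \<open>m\<close>-th powers commute with \<open>n\<close>-th powers, and these together generate the group.
\<close>

context group
begin

text \<open>The centralizer of \<open>c\<close> is a subgroup, so with \<open>g [^] m\<close> and
  \<open>g [^] n\<close> it contains \<open>g\<close>, by Bezout. Since \<open>m > 0\<close>, Bezout
  holds in the form \<open>m * u = n * v + 1\<close> over the naturals, and no negative exponents
  arise.\<close>

lemma commute_if_coprime_pows_commute:
  fixes m n :: nat
  assumes "coprime m n" "m > 0" "g \<in> carrier G" "c \<in> carrier G"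
    and m: "g [^] m \<otimes> c = c \<otimes> g [^] m" and n: "g [^] n \<otimes> c = c \<otimes> g [^] n"
  shows "g \<otimes> c = c \<otimes> g"
proof -
  obtain u v where uv: "m * u = n * v + 1"
    using bezout_nat[of m n] assms by auto
  have "g [^] (n * v) \<otimes> c = c \<otimes> g [^] (n * v)"
    using group_commutes_pow[OF n, of v] assms by (simp add: nat_pow_pow)
  \<comment> \<open>The left factor is \<open>g [^] (m * u)\<close>; cancelling
    \<open>g [^] (n * v)\<close> then leaves the claim for \<open>g\<close>.\<close>
  moreover have "g [^] (n * v) \<otimes> g \<otimes> c = c \<otimes> (g [^] (n * v) \<otimes> g)"
    using group_commutes_pow[OF m, of u] assms by (simp add: nat_pow_pow uv)
  ultimately have "g [^] (n * v) \<otimes> (g \<otimes> c) = g [^] (n * v) \<otimes> (c \<otimes> g)"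
    using assms by (metis m_assoc nat_pow_closed)
  then show ?thesis
    using assms by simp
qed

lemma eq_one_if_coprime_pows_eq_one:
  fixes m n :: nat
  assumes "coprime m n" "m > 0" "c \<in> carrier G" "c [^] m = \<one>" "c [^] n = \<one>"
  shows "c = \<one>"
proof -
  obtain u v where uv: "m * u = n * v + 1"
    using bezout_nat[of m n] assms by auto
  have "c [^] (m * u) = \<one>" "c [^] (n * v) = \<one>"
    using assms by (simp_all flip: nat_pow_pow)
  then show ?thesis
    using uv assms by simp
qed

lemma conj_nat_pow:
  assumes "g \<in> carrier G" "x \<in> carrier G"
  shows "(g \<otimes> x \<otimes> inv g) [^] (k::nat) = g \<otimes> x [^] k \<otimes> inv g"
proof (induction k)
  case (Suc k)
  have "inv g \<otimes> (g \<otimes> (x \<otimes> inv g)) = x \<otimes> inv g"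
    using assms by (simp add: inv_solve_left')
  then show ?case
    using Suc assms by (simp add: m_assoc)
qed (use assms in simp)

text \<open>The hypothesis on \<open>p \<otimes> q\<close> says that \<open>c\<close> is the
  commutator of \<open>p\<close> and \<open>q\<close>. Each of the \<open>k\<close> factors
  \<open>p\<close> moved past \<open>q\<close> releases one \<open>c\<close>, and these collect on
  the left because \<open>p\<close> commutes with \<open>c\<close>.\<close>

lemma nat_pow_commutator:
  assumes "p \<in> carrier G" "q \<in> carrier G" "c \<in> carrier G"
    and pc: "p \<otimes> c = c \<otimes> p" and pq: "p \<otimes> q = c \<otimes> (q \<otimes> p)"
  shows "p [^] (k::nat) \<otimes> q = c [^] k \<otimes> (q \<otimes> p [^] k)"
proof (induction k)
  case (Suc k)
  have "p [^] Suc k \<otimes> q = p [^] k \<otimes> c \<otimes> (q \<otimes> p)"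
    using assms by (simp add: m_assoc)
  also have "\<dots> = c \<otimes> (p [^] k \<otimes> q) \<otimes> p"
    using assms group_commutes_pow[OF pc] by (simp add: m_assoc)
  also have "\<dots> = (c \<otimes> c [^] k) \<otimes> (q \<otimes> (p [^] k \<otimes> p))"
    using Suc assms by (simp add: m_assoc)
  finally show ?case
    using assms by (simp only: nat_pow_Suc2[symmetric] nat_pow_Suc[symmetric])
qed (use assms in simp)

lemma commutator_pow_eq_one:
  assumes "p \<in> carrier G" "q \<in> carrier G" "c \<in> carrier G"
    and "p \<otimes> c = c \<otimes> p" "p \<otimes> q = c \<otimes> (q \<otimes> p)"
    and pow: "p [^] (k::nat) \<otimes> q = q \<otimes> p [^] k"
  shows "c [^] k = \<one>"
  using nat_pow_commutator[of p q c k] assms by simp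

lemma commute_with_mult:
  assumes "a \<in> carrier G" "b \<in> carrier G" "g \<in> carrier G"
    and "g \<otimes> a = a \<otimes> g" "g \<otimes> b = b \<otimes> g"
  shows "g \<otimes> (a \<otimes> b) = a \<otimes> b \<otimes> g"
  using assms by (metis m_assoc)

lemma commutator_of_pows_central:
  fixes m n :: nat
  assumes "coprime m n" "m > 0"
    and m: "\<And>a b. \<lbrakk>a \<in> carrier G; b \<in> carrier G\<rbrakk> \<Longrightarrow> a [^] m \<otimes> b [^] m = b [^] m \<otimes> a [^] m"
    and n: "\<And>a b. \<lbrakk>a \<in> carrier G; b \<in> carrier G\<rbrakk> \<Longrightarrow> a [^] n \<otimes> b [^] n = b [^] n \<otimes> a [^] n"
    and "x \<in> carrier G" "y \<in> carrier G" "g \<in> carrier G"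
  defines "c \<equiv> x [^] m \<otimes> y [^] n \<otimes> inv (x [^] m) \<otimes> inv (y [^] n)"
  shows "g \<otimes> c = c \<otimes> g"
proof -
  define p q where "p = x [^] m" and "q = y [^] n"
  have pq [simp]: "p \<in> carrier G" "q \<in> carrier G"
    using assms by (simp_all add: p_def q_def)
  have "c = p \<otimes> (q \<otimes> inv p \<otimes> inv q)"
    by (simp add: c_def m_assoc flip: p_def q_def)
  \<comment> \<open>Inverses and conjugates of m-th powers are m-th powers: the bracket is the m-th
    power of the conjugate of \<open>inv x\<close> by \<open>q\<close>.\<close>
  also have "\<dots> = x [^] m \<otimes> (q \<otimes> inv x \<otimes> inv q) [^] m"
    using assms by (simp add: conj_nat_pow nat_pow_inv p_def)
  finally have cm: "c = x [^] m \<otimes> (q \<otimes> inv x \<otimes> inv q) [^] m" .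
  have "c = (p \<otimes> q \<otimes> inv p) \<otimes> inv q"
    by (simp add: c_def flip: p_def q_def)
  also have "\<dots> = (p \<otimes> y \<otimes> inv p) [^] n \<otimes> (inv y) [^] n"
    using assms by (simp add: conj_nat_pow nat_pow_inv q_def)
  finally have cn: "c = (p \<otimes> y \<otimes> inv p) [^] n \<otimes> (inv y) [^] n" .
  have "g [^] m \<otimes> c = c \<otimes> g [^] m"
    unfolding cm using assms by (intro commute_with_mult m) auto
  moreover have "g [^] n \<otimes> c = c \<otimes> g [^] n"
    unfolding cn using assms by (intro commute_with_mult n) auto
  moreover have "c \<in> carrier G"
    by (simp add: c_def flip: p_def q_def)
  ultimately show ?thesis
    using commute_if_coprime_pows_commute assms by blast
qed

lemma coprime_pows_commute:
  fixes m n :: nat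
  assumes "coprime m n" "m > 0"
    and m: "\<And>a b. \<lbrakk>a \<in> carrier G; b \<in> carrier G\<rbrakk> \<Longrightarrow> a [^] m \<otimes> b [^] m = b [^] m \<otimes> a [^] m"
    and n: "\<And>a b. \<lbrakk>a \<in> carrier G; b \<in> carrier G\<rbrakk> \<Longrightarrow> a [^] n \<otimes> b [^] n = b [^] n \<otimes> a [^] n"
    and xy: "x \<in> carrier G" "y \<in> carrier G"
  shows "x [^] m \<otimes> y [^] n = y [^] n \<otimes> x [^] m"
proof -
  define p q c where "p = x [^] m" and "q = y [^] n" and "c = p \<otimes> q \<otimes> inv p \<otimes> inv q"
  have carr [simp]: "p \<in> carrier G" "q \<in> carrier G" "c \<in> carrier G"
    using xy by (simp_all add: p_def q_def c_def)
  have central: "g \<otimes> c = c \<otimes> g" if "g \<in> carrier G" for g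
    using commutator_of_pows_central[OF assms that] by (simp add: c_def p_def q_def)
  have pq: "p \<otimes> q = c \<otimes> (q \<otimes> p)"
    by (simp add: c_def m_assoc inv_solve_left')
  \<comment> \<open>Exchanging \<open>p\<close> and \<open>q\<close> inverts the commutator, so the
    power of \<open>q\<close> is handled by the same lemma with \<open>inv c\<close> in place of
    \<open>c\<close>.\<close>
  have qp: "q \<otimes> p = inv c \<otimes> (p \<otimes> q)"
    by (simp add: pq inv_solve_left)
  have "p [^] n = (x [^] n) [^] m" "q [^] m = (y [^] m) [^] n"
    using xy by (simp_all add: p_def q_def nat_pow_pow mult.commute)
  moreover have "p [^] n = (x [^] m) [^] n" "q [^] m = (y [^] n) [^] m"
    by (simp_all add: p_def q_def)
  ultimately have "p [^] n \<otimes> q = q \<otimes> p [^] n" "q [^] m \<otimes> p = p \<otimes> q [^] m"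
    using m n xy by (metis p_def q_def nat_pow_closed)+
  moreover have "q \<otimes> inv c = inv c \<otimes> q"
    using central[of q] by (metis carr inv_closed inv_solve_left inv_solve_right m_assoc m_closed)
  ultimately have "c [^] n = \<one>" "inv c [^] m = \<one>"
    using commutator_pow_eq_one[OF _ _ _ central pq, of n]
      commutator_pow_eq_one[OF _ _ _ _ qp, of m] by (blast intro: carr inv_closed)+
  then have "c = \<one>"
    using eq_one_if_coprime_pows_eq_one[OF assms(1,2), of c] by (simp add: nat_pow_inv)
  then show ?thesis
    using pq xy by (simp add: p_def q_def)
qed

end

theorem theorem3p1:
  fixes G (structure) and m n :: nat
  assumes "m > 0" and "n > 0" and "coprime m n"
    and "group G" and "finite (carrier G)"
    and "\<And>a b. \<lbrakk>a \<in> carrier G; b \<in> carrier G\<rbrakk>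
           \<Longrightarrow> a [^] m \<otimes> b [^] m = b [^] m \<otimes> a [^] m"
    and "\<And>a b. \<lbrakk>a \<in> carrier G; b \<in> carrier G\<rbrakk>
           \<Longrightarrow> a [^] n \<otimes> b [^] n = b [^] n \<otimes> a [^] n"
  shows "comm_group G"
proof -
  interpret group G by fact
  have mn: "x [^] m \<otimes> y [^] n = y [^] n \<otimes> x [^] m"
    if "x \<in> carrier G" "y \<in> carrier G" for x y
    using coprime_pows_commute[of m n x y] assms that by blast
  \<comment> \<open>\<open>y [^] m\<close> commutes with \<open>x [^] m\<close> by hypothesis and
    \<open>y [^] n\<close> does by \<open>mn\<close>; hence so does \<open>y\<close>, and m-th
    powers are central.\<close>
  have m: "y \<otimes> x [^] m = x [^] m \<otimes> y" if x: "x \<in> carrier G" and y: "y \<in> carrier G" for x y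
    by (rule commute_if_coprime_pows_commute[OF assms(3,1) y])
      (use x y assms(6) mn in \<open>simp_all only: nat_pow_closed\<close>)
  have n: "y \<otimes> x [^] n = x [^] n \<otimes> y" if x: "x \<in> carrier G" and y: "y \<in> carrier G" for x y
    by (rule commute_if_coprime_pows_commute[OF assms(3,1) y])
      (use x y assms(7) mn in \<open>simp_all only: nat_pow_closed\<close>)
  show ?thesis
  proof (rule group_comm_groupI)
    fix x y assume xy: "x \<in> carrier G" "y \<in> carrier G"
    show "x \<otimes> y = y \<otimes> x"
      \<comment> \<open>Now \<open>x\<close> itself is recovered from its central powers
        \<open>x [^] m\<close> and \<open>x [^] n\<close>.\<close>
      by (rule commute_if_coprime_pows_commute[OF assms(3,1) xy m[OF xy, symmetric] n[OF xy, symmetric]])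
  qed
qed

end
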